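(* Let $A\in\mathcal B(\mathcal V^N,\mathcal V^m)$ and $\tau,\sigma>0$ be such that $\|A\|^2_{\mathcal B(\mathcal V^N,\mathcal V^m)}\le(\tau\sigma)^{-1}$. Consider the sequence $\{(x^{(n)},\xi^{(n)})\}_{n=1}^\infty$ generated by the primal-dual iteration applied to the problem $$\min_{z\in\mathcal V^N}\mathcal G(z),\qquad \mathcal G(z)=\lambda\|z\|_{1,w;\mathcal V}+\|Az-b\|_{2;\mathcal V},$$ with $x^{(0)}\in\mathcal V^N$ and $\xi^{(0)}=0\in\mathcal V^m$. Then, for any $x\in\mathcal V^N$ and $n\ge1$, $$\mathcal G(\bar x^{(n)})-\mathcal G(x)\le\frac{\tau^{-1}\|x-x^{(0)}\|_{2;\mathcal V}^2+\sigma^{-1}}{n},\qquad \bar x^{(n)}=\frac1n\sum_{k=1}^nx^{(k)}.$$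
   Context: $\mathcal V$ is a separable complex Hilbert space, $N,m\in\mathbb N$, $\lambda>0$, $b\in\mathcal V^m$, and $w=(w_i)_{i=1}^N$ are positive weights. $\|x\|_{1,w;\mathcal V}=\sum_iw_i\|x_i\|_{\mathcal V}$, $\|x\|_{2;\mathcal V}=(\sum_i\|x_i\|_{\mathcal V}^2)^{1/2}$; $\mathcal V^N,\mathcal V^m$ carry the inner product $\langle x,z\rangle_{2;\mathcal V}=\sum_i\langle x_i,z_i\rangle_{\mathcal V}$. $\mathcal B(\mathcal V^N,\mathcal V^m)$ is the space of bounded linear operators. Primal-dual iteration for this problem: let $g(x)=\lambda\|x\|_{1,w;\mathcal V}$ on $\mathcal V^N$ and $h(y)=\|y-b\|_{2;\mathcal V}$ on $\mathcal V^m$, with convex conjugate $h^*(\xi)=\sup_y(\mathrm{Re}\langle y,\xi\rangle_{2;\mathcal V}-h(y))$. With $\mathrm{prox}_\phi(z)=\arg\min_x\{\phi(x)+\frac12\|x-z\|_{2;\mathcal V}^2\}$, the iteration with stepsizes $\tau,\sigma$ is $$x^{(n+1)}=\mathrm{prox}_{\tau g}(x^{(n)}-\tau A^*\xi^{(n)}),\qquad \xi^{(n+1)}=\mathrm{prox}_{\sigma h^*}(\xi^{(n)}+\sigma A(2x^{(n+1)}-x^{(n)})),\quad n=0,1,2,\dots.$$ *)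

theory Defs
  imports "HOL-Analysis.Analysis"
begin

text \<open>
  Complex inner product spaces are set up over the library class of real inner product
  spaces, whose inner product is required to be the real part of the complex one.  Hence
  norm, topology and completeness are the library's, and positive definiteness of
  \<open>cinner\<close> is inherited from \<open>real_inner\<close>.
  Convention: \<open>cinner\<close> is linear in its first argument.
\<close>

class complex_inner = real_inner +
  fixes scaleC :: "complex \<Rightarrow> 'a \<Rightarrow> 'a"  (infixr "*\<^sub>C" 75)
    and cinner :: "'a \<Rightarrow> 'a \<Rightarrow> complex"
  assumes scaleC_add_right: "c *\<^sub>C (x + y) = c *\<^sub>C x + c *\<^sub>C y"
    and scaleC_add_left: "(c + d) *\<^sub>C x = c *\<^sub>C x + d *\<^sub>C x"
    and scaleC_scaleC: "c *\<^sub>C d *\<^sub>C x = (c * d) *\<^sub>C x"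
    and scaleR_scaleC: "r *\<^sub>R x = complex_of_real r *\<^sub>C x"
    and cinner_commute: "cinner x y = cnj (cinner y x)"
    and cinner_add_left: "cinner (x + y) z = cinner x z + cinner y z"
    and cinner_scaleC_left: "cinner (c *\<^sub>C x) y = c * cinner x y"
    and inner_eq_Re_cinner: "inner x y = Re (cinner x y)"

class complex_hilbert = complex_inner + complete_space

instantiation complex :: complex_hilbert
begin

definition scaleC_complex :: "complex \<Rightarrow> complex \<Rightarrow> complex"
  where "scaleC_complex c x = c * x"

definition cinner_complex :: "complex \<Rightarrow> complex \<Rightarrow> complex"
  where "cinner_complex x y = x * cnj y"

instance
  by standard
    (auto simp: scaleC_complex_def cinner_complex_def inner_complex_def algebra_simps
       scaleR_conv_of_real)

end

text \<open>
  The power \<open>V^N\<close> is \<open>'v ^ 'n\<close>; its library norm is the Euclidean combination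
  \<open>sqrt (\<Sum>i. (norm (x $ i))\<^sup>2)\<close> (\<open>norm_vec_def\<close>, \<open>L2_set_def\<close>).
\<close>

instantiation vec :: (complex_inner, finite) complex_inner
begin

definition scaleC_vec :: "complex \<Rightarrow> 'a ^ 'b \<Rightarrow> 'a ^ 'b"
  where "scaleC_vec c x = (\<chi> i. c *\<^sub>C x $ i)"

definition cinner_vec :: "'a ^ 'b \<Rightarrow> 'a ^ 'b \<Rightarrow> complex"
  where "cinner_vec x y = (\<Sum>i\<in>UNIV. cinner (x $ i) (y $ i))"

instance
proof
  fix x y z :: "'a ^ 'b" and c d :: complex and r :: real
  show "c *\<^sub>C (x + y) = c *\<^sub>C x + c *\<^sub>C y"
    by (simp add: scaleC_vec_def vec_eq_iff scaleC_add_right)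
  show "(c + d) *\<^sub>C x = c *\<^sub>C x + d *\<^sub>C x"
    by (simp add: scaleC_vec_def vec_eq_iff scaleC_add_left)
  show "c *\<^sub>C d *\<^sub>C x = (c * d) *\<^sub>C x"
    by (simp add: scaleC_vec_def vec_eq_iff scaleC_scaleC)
  show "r *\<^sub>R x = complex_of_real r *\<^sub>C x"
    by (simp add: scaleC_vec_def vec_eq_iff scaleR_scaleC)
  show "cinner x y = cnj (cinner y x)"
    unfolding cinner_vec_def cnj_sum by (intro sum.cong refl cinner_commute)
  show "cinner (x + y) z = cinner x z + cinner y z"
    by (simp add: cinner_vec_def cinner_add_left sum.distrib)
  show "cinner (c *\<^sub>C x) y = c * cinner x y"
    by (simp add: cinner_vec_def scaleC_vec_def cinner_scaleC_left sum_distrib_left)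
  show "inner x y = Re (cinner x y)"
    by (simp add: inner_vec_def cinner_vec_def inner_eq_Re_cinner)
qed

end

instance vec :: (complex_hilbert, finite) complex_hilbert ..

text \<open>
  The operator norm of a bounded operator is the library's \<open>onorm\<close>.
\<close>

definition bounded_clinear :: "('a::complex_inner \<Rightarrow> 'b::complex_inner) \<Rightarrow> bool"
  where "bounded_clinear A \<longleftrightarrow> bounded_linear A \<and> (\<forall>c x. A (c *\<^sub>C x) = c *\<^sub>C A x)"

text \<open>
  As for the library's \<open>adjoint\<close>, the defining property determines the function uniquely
  if it exists, which is the case for bounded operators on a Hilbert space.
\<close>

definition cadjoint :: "('a::complex_inner \<Rightarrow> 'b::complex_inner) \<Rightarrow> 'b \<Rightarrow> 'a"
  where "cadjoint A = (SOME B. \<forall>x y. cinner (A x) y = cinner x (B y))"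

definition norm_1w :: "real ^ 'n \<Rightarrow> 'v::complex_inner ^ 'n \<Rightarrow> real"
  where "norm_1w w x = (\<Sum>i\<in>UNIV. w $ i * norm (x $ i))"

text \<open>Convex conjugates and arguments of \<open>prox\<close> may take the value \<open>\<infinity>\<close>.\<close>

definition convex_conj :: "('a::complex_inner \<Rightarrow> real) \<Rightarrow> 'a \<Rightarrow> ereal"
  where "convex_conj h \<xi> = (SUP y. ereal (Re (cinner y \<xi>) - h y))"

definition prox :: "('a::complex_inner \<Rightarrow> ereal) \<Rightarrow> 'a \<Rightarrow> 'a"
  where "prox \<phi> z = (ARG_MIN (\<lambda>x. \<phi> x + ereal ((norm (x - z))\<^sup>2 / 2)) x. True)"

definition primal_dual_iteration ::
  "('a::complex_inner \<Rightarrow> real) \<Rightarrow> ('b::complex_inner \<Rightarrow> real) \<Rightarrow> ('a \<Rightarrow> 'b) \<Rightarrow> real \<Rightarrow> real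
    \<Rightarrow> (nat \<Rightarrow> 'a) \<Rightarrow> (nat \<Rightarrow> 'b) \<Rightarrow> bool"
  where "primal_dual_iteration g h A \<tau> \<sigma> x \<xi> \<longleftrightarrow>
    (\<forall>n. x (Suc n) = prox (\<lambda>u. ereal (\<tau> * g u)) (x n - \<tau> *\<^sub>R cadjoint A (\<xi> n)) \<and>
         \<xi> (Suc n) = prox (\<lambda>v. ereal \<sigma> * convex_conj h v)
                       (\<xi> n + \<sigma> *\<^sub>R A (2 *\<^sub>R x (Suc n) - x n)))"

definition objective ::
  "real \<Rightarrow> real ^ 'n \<Rightarrow> ('v::complex_inner ^ 'n \<Rightarrow> 'v ^ 'm) \<Rightarrow> 'v ^ 'm \<Rightarrow> 'v ^ 'n \<Rightarrow> real"
  where "objective lam w A b z = lam * norm_1w w z + norm (A z - b)"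

end

theory Submission
  imports Defs
begin

text \<open>
  The conjugate of \<open>h y = norm (y - b)\<close> is the linear functional \<open>\<xi> \<mapsto> b \<bullet> \<xi>\<close> restricted to the
  closed unit ball, so the iteration looks for a saddle point of the Lagrangian
  \<open>L (x, \<xi>) = g x + A x \<bullet> \<xi> - b \<bullet> \<xi>\<close> with \<open>norm \<xi> \<le> 1\<close>, and \<open>G x\<close> is the maximum of \<open>L (x, \<xi>)\<close> over
  that ball.

  Each proximal step is characterised by a variational inequality
  (\<open>proximal_variational_inequality\<close>).  Adding the inequalities of the primal and the dual step,
  all terms that contain \<open>A\<close> combine with the two distance terms into the quadratic form
  \<open>Q (d, e) = norm d ^ 2 / (2 \<tau>) + norm e ^ 2 / (2 \<sigma>) - A d \<bullet> e\<close>, because the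
  extrapolation \<open>2 x\<^sub>k\<^sub>+\<^sub>1 - x\<^sub>k\<close> is exactly what makes the mixed terms symmetric.  The
  condition on the step sizes says that \<open>Q\<close> is nonnegative, whence for all \<open>u\<close> and all \<open>v\<close> in the
  ball (\<open>primal_dual_step\<close>)
  \<open>L (x\<^sub>k\<^sub>+\<^sub>1, v) - L (u, \<xi>\<^sub>k\<^sub>+\<^sub>1) \<le> Q (u - x\<^sub>k, v - \<xi>\<^sub>k) - Q (u - x\<^sub>k\<^sub>+\<^sub>1, v - \<xi>\<^sub>k\<^sub>+\<^sub>1)\<close>.
  The right-hand side telescopes, and what remains is at most \<open>Q (u - x\<^sub>0, v)\<close>, which is at most
  twice its diagonal part.  Convexity of \<open>g\<close> passes to the average of the \<open>x\<^sub>k\<close>, and the choice of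
  \<open>v\<close> as the direction of the residual at this average turns \<open>L\<close> into the objective.

  The iteration is given by arbitrary minimizers and an arbitrary function with the defining
  property of an adjoint, so the existence of both has to be established.  Both follow from
  one fact (\<open>proximal_minimizer_exists\<close>): in a Hilbert space, a convex continuous function plus
  half the squared distance from a point attains its minimum on a closed convex set.  For a
  linear function this is the Riesz representation theorem.
\<close>

section \<open>Minimization of proximal functionals\<close>

text \<open>
  Strong convexity, by the parallelogram law: any sequence of almost minimizers is a Cauchy
  sequence.
\<close>

lemma proximal_midpoint:
  fixes s t z :: "'a::real_inner"
  assumes "convex_on C \<phi>" "s \<in> C" "t \<in> C"
  shows "\<phi> ((1/2) *\<^sub>R s + (1/2) *\<^sub>R t) + (norm ((1/2) *\<^sub>R s + (1/2) *\<^sub>R t - z))\<^sup>2 / 2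
    \<le> ((\<phi> s + (norm (s - z))\<^sup>2 / 2) + (\<phi> t + (norm (t - z))\<^sup>2 / 2)) / 2 - (norm (s - t))\<^sup>2 / 8"
proof -
  have "\<phi> ((1/2) *\<^sub>R s + (1/2) *\<^sub>R t) \<le> \<phi> s / 2 + \<phi> t / 2"
    using convex_onD[OF assms(1), of "1/2" s t] assms(2,3) by simp
  moreover have "(norm ((1/2) *\<^sub>R s + (1/2) *\<^sub>R t - z))\<^sup>2
      = (norm (s - z))\<^sup>2 / 2 + (norm (t - z))\<^sup>2 / 2 - (norm (s - t))\<^sup>2 / 4"
    by (simp add: power2_norm_eq_inner inner_simps inner_commute field_simps)
  ultimately show ?thesis by (simp add: field_simps)
qed

lemma proximal_minimizer_exists:
  fixes z :: "'a::{real_inner, complete_space}"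
  assumes C: "closed C" "C \<noteq> {}"
    and conv: "convex_on C \<phi>" and cont: "continuous_on C \<phi>"
    and K: "K \<ge> 0" "\<And>u. u \<in> C \<Longrightarrow> - K * norm u \<le> \<phi> u"
  obtains p where "p \<in> C"
    and "\<And>u. u \<in> C \<Longrightarrow> \<phi> p + (norm (p - z))\<^sup>2 / 2 \<le> \<phi> u + (norm (u - z))\<^sup>2 / 2"
proof -
  define F where "F u = \<phi> u + (norm (u - z))\<^sup>2 / 2" for u
  define I where "I = Inf (F ` C)"
  have below: "- K * norm z - K\<^sup>2 / 2 \<le> F u" if "u \<in> C" for u
  proof -
    have "K * norm u \<le> K * (norm z + norm (u - z))"
      using K(1) norm_triangle_ineq[of z "u - z"] by (intro mult_left_mono) auto
    moreover have "0 \<le> (norm (u - z) - K)\<^sup>2" by simp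
    ultimately show ?thesis
      using K(2)[OF that] by (simp add: F_def power2_eq_square algebra_simps)
  qed
  have bdd: "bdd_below (F ` C)"
    by (rule bdd_belowI2) (rule below)
  have I_le: "I \<le> F u" if "u \<in> C" for u
    unfolding I_def using bdd that by (intro cInf_lower) auto
  have "\<exists>u\<in>C. F u < I + 1 / real (Suc k)" for k
    using cInf_lessD[of "F ` C" "I + 1 / real (Suc k)"] C(2) by (auto simp: I_def)
  then obtain s where sC: "\<And>k. s k \<in> C" and sI: "\<And>k. F (s k) < I + 1 / real (Suc k)"
    by metis
  have dist_s: "(norm (s j - s k))\<^sup>2 \<le> 4 * (1 / real (Suc j) + 1 / real (Suc k))" for j k
  proof -
    have "(1/2) *\<^sub>R s j + (1/2) *\<^sub>R s k \<in> C"
      using convexD[of C "s j" "s k" "1/2" "1/2"] convex_on_imp_convex[OF conv] sC by auto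
    from I_le[OF this] show ?thesis
      using proximal_midpoint[OF conv sC sC, of j k z] sI[of j] sI[of k]
      unfolding F_def by argo
  qed
  have "Cauchy s"
  proof (rule metric_CauchyI)
    fix e :: real assume "e > 0"
    then obtain M where M: "inverse (real (Suc M)) < e\<^sup>2 / 8"
      using reals_Archimedean[of "e\<^sup>2 / 8"] by auto
    have "dist (s j) (s k) < e" if "j \<ge> M" "k \<ge> M" for j k
    proof -
      have "1 / real (Suc j) \<le> 1 / real (Suc M)" "1 / real (Suc k) \<le> 1 / real (Suc M)"
        using that by (auto intro!: divide_left_mono)
      then have "(norm (s j - s k))\<^sup>2 < e\<^sup>2"
        using dist_s[of j k] M unfolding inverse_eq_divide by argo
      then show ?thesis
        using \<open>e > 0\<close> by (simp add: dist_norm power2_less_imp_less)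
    qed
    then show "\<exists>M. \<forall>j\<ge>M. \<forall>k\<ge>M. dist (s j) (s k) < e" by blast
  qed
  then obtain p where p: "s \<longlonglongrightarrow> p"
    using Cauchy_convergent convergent_def by blast
  have pC: "p \<in> C"
    using closed_sequentially[OF C(1)] sC p by blast
  have "continuous_on C F"
    unfolding F_def by (auto intro!: continuous_intros cont)
  then have "(\<lambda>k. F (s k)) \<longlonglongrightarrow> F p"
    using pC sC p by (simp add: continuous_on_sequentially o_def)
  moreover have "(\<lambda>k. I + 1 / real (Suc k)) \<longlonglongrightarrow> I + 0"
    unfolding inverse_eq_divide[symmetric]
    by (intro tendsto_add tendsto_const LIMSEQ_inverse_real_of_nat)
  ultimately have "F p \<le> I + 0"
    by (rule LIMSEQ_le) (use sI less_imp_le in blast)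
  then have "F p \<le> F u" if "u \<in> C" for u
    using I_le[OF that] by simp
  then show thesis
    using that pC unfolding F_def by blast
qed

text \<open>
  The first-order optimality condition: \<open>z - p\<close> is a subgradient of \<open>\<phi>\<close> at the minimizer \<open>p\<close>,
  relative to \<open>C\<close>.
\<close>

lemma proximal_variational_inequality:
  fixes z :: "'a::real_inner"
  assumes conv: "convex_on C \<phi>" and pC: "p \<in> C" and uC: "u \<in> C"
    and p_min: "\<And>v. v \<in> C \<Longrightarrow> \<phi> p + (norm (p - z))\<^sup>2 / 2 \<le> \<phi> v + (norm (v - z))\<^sup>2 / 2"
  shows "\<phi> p + inner (z - p) (u - p) \<le> \<phi> u"
proof -
  \<comment> \<open>Compare \<open>p\<close> with the point that lies a fraction \<open>t\<close> of the way towards \<open>u\<close>, and let \<open>t\<close> tend to \<open>0\<close>.\<close>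
  have ineq: "\<phi> p + inner (z - p) (u - p) - \<phi> u \<le> t * ((norm (u - p))\<^sup>2 / 2)"
    if t: "0 < t" "t < 1" for t
  proof -
    define v where "v = (1 - t) *\<^sub>R p + t *\<^sub>R u"
    have "v \<in> C"
      using convexD[of C p u "1 - t" t] convex_on_imp_convex[OF conv] pC uC t
      by (auto simp: v_def)
    moreover have "\<phi> v \<le> (1 - t) * \<phi> p + t * \<phi> u"
      using convex_onD[OF conv, of t p u] pC uC t by (simp add: v_def)
    moreover have "(norm (v - z))\<^sup>2
        = (norm (p - z))\<^sup>2 - 2 * t * inner (z - p) (u - p) + t\<^sup>2 * (norm (u - p))\<^sup>2"
      unfolding v_def power2_norm_eq_inner
      by (simp add: inner_simps inner_commute algebra_simps power2_eq_square)
    ultimately have "\<phi> p \<le> (1 - t) * \<phi> p + t * \<phi> u - t * inner (z - p) (u - p)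
        + t\<^sup>2 * (norm (u - p))\<^sup>2 / 2"
      using p_min[of v] by argo
    then have "t * (\<phi> p + inner (z - p) (u - p) - \<phi> u) \<le> t * (t * ((norm (u - p))\<^sup>2 / 2))"
      by (simp add: algebra_simps power2_eq_square)
    then show ?thesis
      using t by simp
  qed
  have "((\<lambda>t. t * ((norm (u - p))\<^sup>2 / 2)) \<longlongrightarrow> 0 * ((norm (u - p))\<^sup>2 / 2)) (at_right (0::real))"
    by (intro tendsto_intros)
  moreover have "\<forall>\<^sub>F t in at_right (0::real).
      \<phi> p + inner (z - p) (u - p) - \<phi> u \<le> t * ((norm (u - p))\<^sup>2 / 2)"
    using eventually_at_right_real[OF zero_less_one] by eventually_elim (auto intro!: ineq simp del: times_divide_eq_right)
  ultimately have "\<phi> p + inner (z - p) (u - p) - \<phi> u \<le> 0 * ((norm (u - p))\<^sup>2 / 2)"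
    by (rule tendsto_lowerbound) simp
  then show ?thesis by simp
qed

text \<open>
  The extended-valued form: \<open>\<phi>\<close> on \<open>C\<close> and \<open>\<infinity>\<close> elsewhere.  The value \<open>\<infinity>\<close> forces the
  minimizer into \<open>C\<close>.
\<close>

lemma prox_variational_inequality:
  fixes z :: "'a::complex_hilbert"
  assumes C: "closed C" "C \<noteq> {}"
    and conv: "convex_on C \<phi>" and cont: "continuous_on C \<phi>"
    and K: "K \<ge> 0" "\<And>u. u \<in> C \<Longrightarrow> - K * norm u \<le> \<phi> u"
    and \<psi>: "\<And>u. \<psi> u = (if u \<in> C then ereal (\<phi> u) else \<infinity>)"
  shows "prox \<psi> z \<in> C"
    and "\<And>u. u \<in> C \<Longrightarrow> \<phi> (prox \<psi> z) + inner (z - prox \<psi> z) (u - prox \<psi> z) \<le> \<phi> u"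
proof -
  let ?F = "\<lambda>u. \<psi> u + ereal ((norm (u - z))\<^sup>2 / 2)"
  obtain p0 where p0: "p0 \<in> C"
    "\<And>u. u \<in> C \<Longrightarrow> \<phi> p0 + (norm (p0 - z))\<^sup>2 / 2 \<le> \<phi> u + (norm (u - z))\<^sup>2 / 2"
    using proximal_minimizer_exists[OF C conv cont K] by blast
  have "is_arg_min ?F (\<lambda>_. True) p0"
    using p0 by (auto simp: is_arg_min_def \<psi> not_less)
  then have "is_arg_min ?F (\<lambda>_. True) (prox \<psi> z)"
    unfolding prox_def arg_min_def by (rule someI)
  then have le: "?F (prox \<psi> z) \<le> ?F u" for u
    by (auto simp: is_arg_min_def not_less)
  show in_C: "prox \<psi> z \<in> C"
    using le[of p0] p0(1) by (auto simp: \<psi> split: if_splits)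
  show "\<phi> (prox \<psi> z) + inner (z - prox \<psi> z) (u - prox \<psi> z) \<le> \<phi> u" if "u \<in> C" for u
  proof (rule proximal_variational_inequality[OF conv in_C that])
    show "\<phi> (prox \<psi> z) + (norm (prox \<psi> z - z))\<^sup>2 / 2 \<le> \<phi> v + (norm (v - z))\<^sup>2 / 2"
      if "v \<in> C" for v
      using le[of v] in_C that by (simp add: \<psi>)
  qed
qed

section \<open>Riesz representation and adjoints\<close>

text \<open>
  The representing vector is the minimizer of \<open>u \<mapsto> norm u ^ 2 / 2 - f u\<close>, whose variational
  inequality is an identity because the direction may be reversed.
\<close>

lemma riesz_representation_real:
  fixes f :: "'a::{real_inner, complete_space} \<Rightarrow> real"
  assumes f: "bounded_linear f"
  obtains p where "\<And>v. f v = inner v p"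
proof -
  interpret f: bounded_linear f by fact
  obtain K where K: "K \<ge> 0" "\<And>u. norm (f u) \<le> norm u * K"
    using f.nonneg_bounded by blast
  have conv: "convex_on UNIV (\<lambda>u. - f u)"
    by (auto intro!: convex_onI simp: f.add f.diff f.scaleR algebra_simps)
  have bound: "- K * norm u \<le> - f u" for u
    using K(2)[of u] by (simp add: mult.commute)
  obtain p where p: "\<And>u. - f p + (norm (p - 0))\<^sup>2 / 2 \<le> - f u + (norm (u - 0))\<^sup>2 / 2"
    using proximal_minimizer_exists[of UNIV "\<lambda>u. - f u" K 0]
      conv K(1) bound f.continuous_on[of UNIV "\<lambda>u. u"] continuous_on_minus continuous_on_id
    by (metis UNIV_I UNIV_not_empty closed_UNIV)
  have ineq: "f v \<le> inner v p" for v
    using proximal_variational_inequality[OF conv, of p "p + v" 0] p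
    by (simp add: f.add inner_commute)
  have "f v = inner v p" for v
    using ineq[of v] ineq[of "- v"] by (simp add: f.neg)
  then show thesis by (rule that)
qed

text \<open>
  The real adjoint of a complex linear operator is also its complex adjoint: the imaginary part
  of \<open>cinner x y\<close> is the real part of \<open>cinner (- \<i> x) y\<close>.
\<close>

lemma cinner_eq_if_inner_eq:
  fixes A :: "'a::complex_inner \<Rightarrow> 'b::complex_inner"
  assumes "bounded_clinear A" and eq: "\<And>x. inner (A x) y = inner x z"
  shows "cinner (A x) y = cinner x z"
proof -
  have "Re (cinner (A ((- \<i>) *\<^sub>C x)) y) = Re (cinner ((- \<i>) *\<^sub>C x) z)"
    using eq[of "(- \<i>) *\<^sub>C x"] by (simp add: inner_eq_Re_cinner)
  moreover have "A ((- \<i>) *\<^sub>C x) = (- \<i>) *\<^sub>C A x"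
    using assms(1) unfolding bounded_clinear_def by blast
  ultimately have "Im (cinner (A x) y) = Im (cinner x z)"
    by (simp add: cinner_scaleC_left)
  then show ?thesis
    using eq[of x] by (simp add: complex_eq_iff inner_eq_Re_cinner)
qed

lemma inner_cadjoint:
  fixes A :: "'a::complex_hilbert \<Rightarrow> 'b::complex_inner"
  assumes A: "bounded_clinear A"
  shows "inner (A x) y = inner x (cadjoint A y)"
proof -
  have lin: "bounded_linear A"
    using A by (simp add: bounded_clinear_def)
  have "\<exists>z. \<forall>x. cinner (A x) y = cinner x z" for y
  proof -
    have "bounded_linear (\<lambda>x. inner (A x) y)"
      by (rule bounded_linear_compose[OF bounded_linear_inner_left lin])
    then obtain z where "\<And>x. inner (A x) y = inner x z"
      by (rule riesz_representation_real) blast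
    then show ?thesis
      using cinner_eq_if_inner_eq[OF A] by blast
  qed
  then have "\<exists>B. \<forall>x y. cinner (A x) y = cinner x (B y)"
    by metis
  then have "\<forall>x y. cinner (A x) y = cinner x (cadjoint A y)"
    unfolding cadjoint_def by (rule someI_ex)
  then show ?thesis
    by (simp add: inner_eq_Re_cinner)
qed

section \<open>The two functionals\<close>

lemma convex_on_norm_1w:
  fixes w :: "real ^ 'n"
  assumes "\<And>i. w $ i \<ge> 0"
  shows "convex_on UNIV (norm_1w w :: 'v::complex_inner ^ 'n \<Rightarrow> real)"
proof (rule convex_onI)
  fix t :: real and x y :: "'v ^ 'n" assume t: "0 < t" "t < 1"
  have "w $ i * norm (((1 - t) *\<^sub>R x + t *\<^sub>R y) $ i)
      \<le> (1 - t) * (w $ i * norm (x $ i)) + t * (w $ i * norm (y $ i))" for i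
  proof -
    have "norm (((1 - t) *\<^sub>R x + t *\<^sub>R y) $ i) \<le> (1 - t) * norm (x $ i) + t * norm (y $ i)"
      using norm_triangle_ineq[of "(1 - t) *\<^sub>R x $ i" "t *\<^sub>R y $ i"] t by simp
    from mult_left_mono[OF this assms[of i]] show ?thesis
      by (simp add: algebra_simps)
  qed
  then show "norm_1w w ((1 - t) *\<^sub>R x + t *\<^sub>R y) \<le> (1 - t) * norm_1w w x + t * norm_1w w y"
    unfolding norm_1w_def sum_distrib_left sum.distrib[symmetric] by (intro sum_mono)
qed simp

lemma continuous_on_norm_1w: "continuous_on S (norm_1w w)"
  unfolding norm_1w_def by (intro continuous_intros)

lemma norm_1w_nonneg: "(\<And>i. w $ i \<ge> 0) \<Longrightarrow> norm_1w w x \<ge> 0"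
  unfolding norm_1w_def by (intro sum_nonneg) simp

lemma convex_conj_norm_diff:
  fixes b :: "'a::complex_inner"
  shows "convex_conj (\<lambda>y. norm (y - b)) \<xi> = (if \<xi> \<in> cball 0 1 then ereal (inner b \<xi>) else \<infinity>)"
proof (cases "norm \<xi> \<le> 1")
  case True
  have "inner y \<xi> - norm (y - b) \<le> inner b \<xi>" for y
  proof -
    have "inner (y - b) \<xi> \<le> norm (y - b) * norm \<xi>"
      by (rule norm_cauchy_schwarz)
    also have "\<dots> \<le> norm (y - b) * 1"
      using True by (intro mult_left_mono) auto
    finally show ?thesis by (simp add: inner_diff_left)
  qed
  then have "convex_conj (\<lambda>y. norm (y - b)) \<xi> \<le> ereal (inner b \<xi>)"
    unfolding convex_conj_def by (intro SUP_least) (simp add: inner_eq_Re_cinner)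
  moreover have "ereal (inner b \<xi>) \<le> convex_conj (\<lambda>y. norm (y - b)) \<xi>"
    unfolding convex_conj_def by (rule SUP_upper2[of b]) (simp_all add: inner_eq_Re_cinner)
  ultimately show ?thesis
    using True by simp
next
  case False
  have "\<exists>y\<in>UNIV. ereal (real k) \<le> ereal (Re (cinner y \<xi>) - norm (y - b))" for k
  proof
    \<comment> \<open>Moving from \<open>b\<close> in direction \<open>\<xi>\<close> makes the difference grow at the positive rate \<open>norm \<xi> * (norm \<xi> - 1)\<close>.\<close>
    define c where "c = norm \<xi> * (norm \<xi> - 1)"
    define t where "t = (real k + \<bar>inner b \<xi>\<bar>) / c"
    have "c > 0"
      using False unfolding c_def by (intro mult_pos_pos) linarith+
    then have "t \<ge> 0" "t * c = real k + \<bar>inner b \<xi>\<bar>"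
      by (simp_all add: t_def)
    then have "inner (b + t *\<^sub>R \<xi>) \<xi> - norm (b + t *\<^sub>R \<xi> - b) \<ge> real k"
      by (simp add: inner_add_left power2_norm_eq_inner[symmetric] c_def power2_eq_square
          algebra_simps)
    then show "ereal (real k) \<le> ereal (Re (cinner (b + t *\<^sub>R \<xi>) \<xi>) - norm (b + t *\<^sub>R \<xi> - b))"
      by (simp add: inner_eq_Re_cinner)
  qed simp
  then have "convex_conj (\<lambda>y. norm (y - b)) \<xi> = \<infinity>"
    unfolding convex_conj_def by (rule SUP_PInfty)
  then show ?thesis
    using False by simp
qed

section \<open>Descent of the primal-dual quadratic form\<close>

definition step_form ::
  "real \<Rightarrow> real \<Rightarrow> ('a::real_inner \<Rightarrow> 'b::real_inner) \<Rightarrow> 'a \<Rightarrow> 'b \<Rightarrow> real"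
  where "step_form \<tau> \<sigma> A d e = (norm d)\<^sup>2 / (2 * \<tau>) + (norm e)\<^sup>2 / (2 * \<sigma>) - inner (A d) e"

text \<open>
  Young's inequality for \<open>norm d / sqrt \<tau>\<close> and \<open>norm e / sqrt \<sigma>\<close>; the condition on the step sizes
  bounds \<open>norm (A d)\<close> by \<open>norm d / sqrt (\<tau> * \<sigma>)\<close>.
\<close>

lemma abs_inner_le_half_squares:
  fixes A :: "'a::real_inner \<Rightarrow> 'b::real_inner"
  assumes A: "bounded_linear A" and pos: "\<tau> > 0" "\<sigma> > 0"
    and step: "(onorm A)\<^sup>2 \<le> inverse (\<tau> * \<sigma>)"
  shows "\<bar>inner (A d) e\<bar> \<le> (norm d)\<^sup>2 / (2 * \<tau>) + (norm e)\<^sup>2 / (2 * \<sigma>)"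
proof -
  define r where "r = norm d / sqrt \<tau>"
  define s where "s = norm e / sqrt \<sigma>"
  have "onorm A \<le> 1 / (sqrt \<tau> * sqrt \<sigma>)"
    using real_le_rsqrt[OF step] by (simp add: real_sqrt_mult real_sqrt_inverse inverse_eq_divide real_sqrt_divide)
  then have "onorm A * (norm d * norm e) \<le> 1 / (sqrt \<tau> * sqrt \<sigma>) * (norm d * norm e)"
    by (intro mult_right_mono) auto
  moreover have "\<bar>inner (A d) e\<bar> \<le> norm (A d) * norm e"
    by (rule Cauchy_Schwarz_ineq2)
  moreover have "norm (A d) * norm e \<le> onorm A * norm d * norm e"
    by (intro mult_right_mono onorm[OF A]) auto
  ultimately have "\<bar>inner (A d) e\<bar> \<le> r * s"
    by (simp add: r_def s_def mult.assoc)
  also have "\<dots> \<le> r\<^sup>2 / 2 + s\<^sup>2 / 2"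
    using sum_squares_bound[of r s] by simp
  also have "\<dots> = (norm d)\<^sup>2 / (2 * \<tau>) + (norm e)\<^sup>2 / (2 * \<sigma>)"
    using pos by (simp add: r_def s_def power_divide)
  finally show ?thesis .
qed

text \<open>
  The left-hand side is the difference of the Lagrangian \<open>g x + A x \<bullet> \<xi> - f \<xi>\<close> at \<open>(p, v)\<close> and
  \<open>(u, q)\<close>.  With \<open>B\<close> the polar form of the quadratic form, the two variational inequalities bound
  it by \<open>- 2 B (a, c)\<close>, where \<open>a\<close> is the step from \<open>(p, q)\<close> back to \<open>(x, \<xi>)\<close> and \<open>c\<close> the one from
  \<open>(p, q)\<close> to \<open>(u, v)\<close>.  This equals the right-hand side minus the form at \<open>a\<close>.
\<close>

lemma primal_dual_step:
  fixes A :: "'a::real_inner \<Rightarrow> 'b::real_inner"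
  assumes A: "bounded_linear A" and adj: "\<And>x y. inner (A x) y = inner x (A' y)"
    and pos: "\<tau> > 0" "\<sigma> > 0" and step: "(onorm A)\<^sup>2 \<le> inverse (\<tau> * \<sigma>)"
    and primal: "\<tau> * g p + inner (x - \<tau> *\<^sub>R A' \<xi> - p) (u - p) \<le> \<tau> * g u"
    and dual: "\<sigma> * f q + inner (\<xi> + \<sigma> *\<^sub>R A (2 *\<^sub>R p - x) - q) (v - q) \<le> \<sigma> * f v"
  shows "(g p + inner (A p) v - f v) - (g u + inner (A u) q - f q)
    \<le> step_form \<tau> \<sigma> A (u - x) (v - \<xi>) - step_form \<tau> \<sigma> A (u - p) (v - q)"
proof -
  interpret A: bounded_linear A by fact
  have "\<tau> * g p - \<tau> * g u \<le> \<tau> * inner (A (u - p)) \<xi> - inner (x - p) (u - p)"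
    using primal unfolding adj
    by (simp add: inner_diff_left inner_commute[of "A' \<xi>"] right_diff_distrib)
  then have "(\<tau> * g p - \<tau> * g u) / \<tau> \<le> (\<tau> * inner (A (u - p)) \<xi> - inner (x - p) (u - p)) / \<tau>"
    using pos by (intro divide_right_mono) auto
  then have 1: "g p - g u \<le> inner (A (u - p)) \<xi> - inner (x - p) (u - p) / \<tau>"
    using pos by (simp add: diff_divide_distrib)
  have "\<sigma> * f q - \<sigma> * f v \<le> - (\<sigma> * inner (A (2 *\<^sub>R p - x)) (v - q)) - inner (\<xi> - q) (v - q)"
    using dual by (simp add: inner_diff_left inner_add_left)
  then have "(\<sigma> * f q - \<sigma> * f v) / \<sigma>
      \<le> (- (\<sigma> * inner (A (2 *\<^sub>R p - x)) (v - q)) - inner (\<xi> - q) (v - q)) / \<sigma>"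
    using pos by (intro divide_right_mono) auto
  then have 2: "f q - f v \<le> - inner (A (2 *\<^sub>R p - x)) (v - q) - inner (\<xi> - q) (v - q) / \<sigma>"
    using pos by (simp add: diff_divide_distrib)
  have 3: "0 \<le> step_form \<tau> \<sigma> A (x - p) (\<xi> - q)"
    using abs_inner_le_half_squares[OF A pos step, of "x - p" "\<xi> - q"] by (simp add: step_form_def)
  have polar_x: "(norm (u - x))\<^sup>2 / (2 * \<tau>)
      = (norm (u - p))\<^sup>2 / (2 * \<tau>) + (norm (x - p))\<^sup>2 / (2 * \<tau>) - inner (x - p) (u - p) / \<tau>"
    using pos by (simp add: power2_norm_eq_inner inner_simps inner_commute field_simps)
  have polar_\<xi>: "(norm (v - \<xi>))\<^sup>2 / (2 * \<sigma>)
      = (norm (v - q))\<^sup>2 / (2 * \<sigma>) + (norm (\<xi> - q))\<^sup>2 / (2 * \<sigma>) - inner (\<xi> - q) (v - q) / \<sigma>"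
    using pos by (simp add: power2_norm_eq_inner inner_simps inner_commute field_simps)
  have cross: "inner (A (u - p)) \<xi> - inner (A (2 *\<^sub>R p - x)) (v - q) + inner (A p) v - inner (A u) q
      = inner (A (u - p)) (v - q) + inner (A (x - p)) (\<xi> - q) - inner (A (u - x)) (v - \<xi>)"
    by (simp add: A.diff A.scaleR inner_simps)
  from 1 2 3 polar_x polar_\<xi> cross show ?thesis
    unfolding step_form_def by argo
qed

section \<open>The ergodic estimate\<close>

theorem lemma9p2:
  fixes A :: "'v::complex_hilbert ^ 'n \<Rightarrow> 'v ^ 'm"
    and b :: "'v ^ 'm" and w :: "real ^ 'n" and lam \<tau> \<sigma> :: real
    and X :: "nat \<Rightarrow> 'v ^ 'n" and \<Xi> :: "nat \<Rightarrow> 'v ^ 'm"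
    and x :: "'v ^ 'n" and n :: nat
  assumes "separable_space (euclidean :: 'v topology)"
    and "lam > 0" and "\<And>i. w $ i > 0"
    and "bounded_clinear A"
    and "\<tau> > 0" and "\<sigma> > 0"
    and "(onorm A)\<^sup>2 \<le> inverse (\<tau> * \<sigma>)"
    and "primal_dual_iteration (\<lambda>z. lam * norm_1w w z) (\<lambda>y. norm (y - b)) A \<tau> \<sigma> X \<Xi>"
    and "\<Xi> 0 = 0"
    and "n \<ge> 1"
  shows "objective lam w A b ((1 / real n) *\<^sub>R (\<Sum>k=1..n. X k)) - objective lam w A b x
    \<le> (inverse \<tau> * (norm (x - X 0))\<^sup>2 + inverse \<sigma>) / real n"
proof -
  have lin: "bounded_linear A"
    using assms(4) by (simp add: bounded_clinear_def)
  interpret A: bounded_linear A by fact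
  define g where "g z = lam * norm_1w w z" for z :: "'v ^ 'n"
  have w: "\<And>i. w $ i \<ge> 0"
    using assms(3) less_imp_le by blast
  have g_conv: "convex_on UNIV g"
    unfolding g_def using assms(2) convex_on_norm_1w[OF w] by (intro convex_on_cmul) auto
  have \<tau>g: "convex_on UNIV (\<lambda>u. \<tau> * g u)" "continuous_on UNIV (\<lambda>u. \<tau> * g u)"
    "\<And>u. - 0 * norm u \<le> \<tau> * g u"
    using assms(2,5) g_conv norm_1w_nonneg[OF w] unfolding g_def
    by (auto intro!: convex_on_cmul continuous_intros continuous_on_norm_1w
        convex_on_norm_1w[OF w] mult_nonneg_nonneg)
  have primal: "\<tau> * g (X (Suc k))
      + inner (X k - \<tau> *\<^sub>R cadjoint A (\<Xi> k) - X (Suc k)) (u - X (Suc k)) \<le> \<tau> * g u" for k u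
  proof -
    have "X (Suc k) = prox (\<lambda>u. ereal (\<tau> * g u)) (X k - \<tau> *\<^sub>R cadjoint A (\<Xi> k))"
      using assms(8) by (simp add: primal_dual_iteration_def g_def)
    then show ?thesis
      using prox_variational_inequality(2)[OF closed_UNIV UNIV_not_empty \<tau>g(1,2) order_refl \<tau>g(3)]
      by simp
  qed
  have ball: "closed (cball 0 1)" "cball 0 1 \<noteq> ({} :: ('v ^ 'm) set)"
    by auto
  have lin_b: "convex_on (cball 0 1) (\<lambda>v. \<sigma> * inner b v)"
    "continuous_on (cball 0 1) (\<lambda>v. \<sigma> * inner b v)"
    by (auto intro!: convex_onI continuous_intros simp: inner_simps algebra_simps)
  have bound_b: "0 \<le> \<sigma> * norm b" "- (\<sigma> * norm b) * norm v \<le> \<sigma> * inner b v" for v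
  proof -
    have "- (norm b * norm v) \<le> inner b v"
      using Cauchy_Schwarz_ineq2[of b v] by simp
    from mult_left_mono[OF this, of \<sigma>] show "- (\<sigma> * norm b) * norm v \<le> \<sigma> * inner b v"
      using assms(6) by (simp add: mult.assoc)
  qed (use assms(6) in simp)
  have conj: "ereal \<sigma> * convex_conj (\<lambda>y. norm (y - b)) v
      = (if v \<in> cball 0 1 then ereal (\<sigma> * inner b v) else \<infinity>)" for v
    using assms(6) by (simp add: convex_conj_norm_diff)
  note dual_prox = prox_variational_inequality[OF ball lin_b bound_b conj]
  have \<Xi>_Suc: "\<Xi> (Suc k) = prox (\<lambda>v. ereal \<sigma> * convex_conj (\<lambda>y. norm (y - b)) v)
      (\<Xi> k + \<sigma> *\<^sub>R A (2 *\<^sub>R X (Suc k) - X k))" for k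
    using assms(8) by (simp add: primal_dual_iteration_def)
  have \<Xi>_ball: "norm (\<Xi> (Suc k)) \<le> 1" for k
    using dual_prox(1) unfolding \<Xi>_Suc by (simp add: mem_cball_0)
  have dual: "\<sigma> * inner b (\<Xi> (Suc k)) + inner (\<Xi> k + \<sigma> *\<^sub>R A (2 *\<^sub>R X (Suc k) - X k)
      - \<Xi> (Suc k)) (v - \<Xi> (Suc k)) \<le> \<sigma> * inner b v" if "norm v \<le> 1" for k v
    using dual_prox(2)[of v] that unfolding \<Xi>_Suc by (simp add: mem_cball_0)

  define xbar where "xbar = (1 / real n) *\<^sub>R (\<Sum>k=1..n. X k)"
  have n: "real n > 0"
    using assms(10) by simp
  \<comment> \<open>If the residual vanishes, then \<open>v = 0\<close>, which also lies in the ball.\<close>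
  define v where "v = sgn (A xbar - b)"
  have v: "norm v \<le> 1"
    by (simp add: v_def norm_sgn)
  have v_residual: "inner (A xbar - b) v = norm (A xbar - b)"
    by (cases "A xbar = b")
      (simp_all add: v_def sgn_div_norm power2_norm_eq_inner[symmetric] power2_eq_square)
  define Q where "Q k = step_form \<tau> \<sigma> A (x - X k) (v - \<Xi> k)" for k
  define r where "r = g x + norm (A x - b)"

  have step: "g (X (Suc k)) + inner (A (X (Suc k)) - b) v - r \<le> Q k - Q (Suc k)" for k
  proof -
    have "inner (A x - b) (\<Xi> (Suc k)) \<le> norm (A x - b) * norm (\<Xi> (Suc k))"
      by (rule norm_cauchy_schwarz)
    also have "\<dots> \<le> norm (A x - b) * 1"
      using \<Xi>_ball by (intro mult_left_mono) auto
    finally have "inner (A x - b) (\<Xi> (Suc k)) \<le> norm (A x - b)"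
      by simp
    with primal_dual_step[where g = g and f = "\<lambda>v. inner b v", OF lin inner_cadjoint[OF assms(4)]
        assms(5-7) primal[of k x] dual[OF v, of k]]
    show ?thesis
      unfolding Q_def r_def inner_diff_left by argo
  qed
  have half: "a / (2 * t) = inverse t * a / 2" for a t :: real
    by (simp add: inverse_eq_divide)
  have "(\<Sum>k<n. g (X (Suc k)) + inner (A (X (Suc k)) - b) v - r) \<le> (\<Sum>k<n. Q k - Q (Suc k))"
    by (intro sum_mono step)
  also have "\<dots> = Q 0 - Q n"
    by (rule sum_lessThan_telescope')
  also have "\<dots> \<le> Q 0"
    using abs_inner_le_half_squares[OF lin assms(5-7), of "x - X n" "v - \<Xi> n"]
    by (simp add: Q_def step_form_def)
  also have "\<dots> \<le> inverse \<tau> * (norm (x - X 0))\<^sup>2 + inverse \<sigma> * (norm v)\<^sup>2"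
    using abs_inner_le_half_squares[OF lin assms(5-7), of "x - X 0" v]
    unfolding Q_def step_form_def assms(9) diff_zero half by linarith
  also have "\<dots> \<le> inverse \<tau> * (norm (x - X 0))\<^sup>2 + inverse \<sigma>"
    using v assms(6) by (simp add: power_le_one)
  finally have total: "(\<Sum>k=1..n. g (X k) + inner (A (X k) - b) v - r)
      \<le> inverse \<tau> * (norm (x - X 0))\<^sup>2 + inverse \<sigma>"
    by (simp add: sum.atLeast1_atMost_eq)

  have "g xbar \<le> (\<Sum>k=1..n. (1 / real n) * g (X k))"
    unfolding xbar_def scaleR_sum_right
    using assms(10) by (intro convex_on_sum[OF _ _ g_conv]) auto
  then have "g xbar \<le> (\<Sum>k=1..n. g (X k)) / real n"
    by (simp add: sum_divide_distrib)
  then have g_mean: "real n * g xbar \<le> (\<Sum>k=1..n. g (X k))"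
    using n by (simp add: field_simps)
  have "real n *\<^sub>R xbar = (\<Sum>k=1..n. X k)"
    using n by (simp add: xbar_def)
  then have "(\<Sum>k=1..n. A (X k)) = real n *\<^sub>R A xbar"
    by (metis A.sum A.scaleR)
  then have "(\<Sum>k=1..n. inner (A (X k) - b) v) = real n * inner (A xbar - b) v"
    by (simp add: inner_diff_left sum_subtractf inner_sum_left[symmetric] algebra_simps)
  then have "real n * (g xbar + norm (A xbar - b) - r)
      \<le> (\<Sum>k=1..n. g (X k) + inner (A (X k) - b) v - r)"
    using g_mean v_residual by (simp add: sum.distrib sum_subtractf algebra_simps)
  with total have "real n * (g xbar + norm (A xbar - b) - r)
      \<le> inverse \<tau> * (norm (x - X 0))\<^sup>2 + inverse \<sigma>"
    by simp
  then show ?thesis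
    using n unfolding xbar_def[symmetric] objective_def r_def g_def
    by (simp add: pos_le_divide_eq mult.commute)
qed

end
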